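(* Let $F:\mathbf{Comp}\to\mathbf{T}$ be a monomorphic functor with finite supports. Then $F$ is epimorphic, and its maximal $\emptyset$-modification $F^\circ:\mathbf{Comp}\to\mathbf{T}$ preserves intersections.
   Context: $\mathbf{Comp}$ is the category of compact Hausdorff spaces (including $\emptyset$) and their continuous maps. $\mathbf{T}$ is the category whose objects are topological spaces and whose morphisms are all (not necessarily continuous) functions between topological spaces. A functor $F:\mathbf{Comp}\to\mathbf{T}$ is monomorphic if it preserves monomorphisms (injective maps), and epimorphic if it preserves epimorphisms (which coincide with surjective maps in both categories). It has finite supports if for each compact Hausdorff space $X$ and each $a\in FX$ there is a map $f:A\to X$ from a finite discrete space $A$ such that $a\in Ff(FA)$. A finite ordinal $n$ is identified with the finite discrete space $\{0,\dots,n-1\}$. The maximal $\emptyset$-modification $F^\circ$ of a monomorphic functor $F$ is the monomorphic functor defined as follows. On objects: $F^\circ X=FX$ for non-empty $X$, and $F^\circ\emptyset=\{a\in F1: Ff_0(a)=Ff_1(a)\}\subset F1$ (with the subspace topology), where $f_i:1\to 2$ is the constant map with value $i$. On a morphism $f:X\to Y$: $F^\circ f=Ff$ if $X\neq\emptyset$; $F^\circ f$ is the identity of $F^\circ\emptyset$ if $X=Y=\emptyset$; and if $X=\emptyset\ne Y$, then $F^\circ f=Fg|_{F^\circ\emptyset}:F^\circ\emptyset\to FY$, where $g:1\to Y$ is any map (the result does not depend on $g$). For compact Hausdorff spaces $A\subset B$, $i^A_B:A\to B$ denotes the identity embedding. A functor $G:\mathbf{Comp}\to\mathbf{T}$ preserves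 intersections if for any compact Hausdorff space $X$ and any closed subsets $X_\alpha\subset X$, $\alpha\in A$, with intersection $Z=\bigcap_{\alpha\in A}X_\alpha$, one has $G i^Z_X(GZ)=\bigcap_{\alpha\in A}G i^{X_\alpha}_X(GX_\alpha)$. *)

theory Defs
  imports "HOL-Analysis.Abstract_Topological_Spaces"
begin

section \<open>Categories and functors\<close>

record ('o, 'm) cat =
  Obj :: "'o set"
  Hom :: "'o \<Rightarrow> 'o \<Rightarrow> 'm set"
  Ident :: "'o \<Rightarrow> 'm"
  Cmp :: "'o \<Rightarrow> 'm \<Rightarrow> 'm \<Rightarrow> 'm"
    \<comment> \<open>\<open>Cmp C X g f\<close> is the composite of \<open>g\<close> after \<open>f\<close>, where \<open>X\<close> is the domain of \<open>f\<close>\<close>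

record ('o, 'm, 'p, 'n) func =
  omap :: "'o \<Rightarrow> 'p"
  mmap :: "'o \<Rightarrow> 'o \<Rightarrow> 'm \<Rightarrow> 'n"

definition is_functor ::
  "('o, 'm) cat \<Rightarrow> ('p, 'n) cat \<Rightarrow> ('o, 'm, 'p, 'n) func \<Rightarrow> bool" where
  "is_functor C D F \<longleftrightarrow>
     (\<forall>X\<in>Obj C. omap F X \<in> Obj D) \<and>
     (\<forall>X\<in>Obj C. \<forall>Y\<in>Obj C. \<forall>f\<in>Hom C X Y. mmap F X Y f \<in> Hom D (omap F X) (omap F Y)) \<and>
     (\<forall>X\<in>Obj C. mmap F X X (Ident C X) = Ident D (omap F X)) \<and>
     (\<forall>X\<in>Obj C. \<forall>Y\<in>Obj C. \<forall>Z\<in>Obj C. \<forall>f\<in>Hom C X Y. \<forall>g\<in>Hom C Y Z.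
        mmap F X Z (Cmp C X g f) = Cmp D (omap F X) (mmap F Y Z g) (mmap F X Y f))"

definition is_mono :: "('o, 'm) cat \<Rightarrow> 'o \<Rightarrow> 'o \<Rightarrow> 'm \<Rightarrow> bool" where
  "is_mono C X Y f \<longleftrightarrow> f \<in> Hom C X Y \<and>
     (\<forall>Z\<in>Obj C. \<forall>g\<in>Hom C Z X. \<forall>h\<in>Hom C Z X. Cmp C Z f g = Cmp C Z f h \<longrightarrow> g = h)"

definition is_epi :: "('o, 'm) cat \<Rightarrow> 'o \<Rightarrow> 'o \<Rightarrow> 'm \<Rightarrow> bool" where
  "is_epi C X Y f \<longleftrightarrow> f \<in> Hom C X Y \<and>
     (\<forall>Z\<in>Obj C. \<forall>g\<in>Hom C Y Z. \<forall>h\<in>Hom C Y Z. Cmp C X g f = Cmp C X h f \<longrightarrow> g = h)"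

definition monomorphic ::
  "('o, 'm) cat \<Rightarrow> ('p, 'n) cat \<Rightarrow> ('o, 'm, 'p, 'n) func \<Rightarrow> bool" where
  "monomorphic C D F \<longleftrightarrow>
     (\<forall>X\<in>Obj C. \<forall>Y\<in>Obj C. \<forall>f. is_mono C X Y f \<longrightarrow>
        is_mono D (omap F X) (omap F Y) (mmap F X Y f))"

definition epimorphic ::
  "('o, 'm) cat \<Rightarrow> ('p, 'n) cat \<Rightarrow> ('o, 'm, 'p, 'n) func \<Rightarrow> bool" where
  "epimorphic C D F \<longleftrightarrow>
     (\<forall>X\<in>Obj C. \<forall>Y\<in>Obj C. \<forall>f. is_epi C X Y f \<longrightarrow>
        is_epi D (omap F X) (omap F Y) (mmap F X Y f))"

section \<open>The categories Comp and T\<close>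

text \<open>The spaces are those whose points lie in a type that acts as universe. A map
  between spaces is represented by the function that is \<^const>\<open>undefined\<close> outside its
  domain, so that equality of morphisms is equality of maps.\<close>

definition Comp :: "('a topology, 'a \<Rightarrow> 'a) cat" where
  "Comp = \<lparr>Obj = {X. compact_space X \<and> Hausdorff_space X},
     Hom = (\<lambda>X Y. {f. continuous_map X Y f} \<inter> extensional (topspace X)),
     Ident = (\<lambda>X. \<lambda>x\<in>topspace X. x),
     Cmp = (\<lambda>X. compose (topspace X))\<rparr>"

definition TopSet :: "('a topology, 'a \<Rightarrow> 'a) cat" where
  "TopSet = \<lparr>Obj = UNIV,
     Hom = (\<lambda>X Y. topspace X \<rightarrow>\<^sub>E topspace Y),
     Ident = (\<lambda>X. \<lambda>x\<in>topspace X. x),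
     Cmp = (\<lambda>X. compose (topspace X))\<rparr>"

type_synonym ('a, 'b) comp_func = "('a topology, 'a \<Rightarrow> 'a, 'b topology, 'b \<Rightarrow> 'b) func"

definition finite_supports :: "('a, 'b) comp_func \<Rightarrow> bool" where
  "finite_supports F \<longleftrightarrow>
     (\<forall>X\<in>Obj Comp. \<forall>a\<in>topspace (omap F X). \<exists>S f. finite S \<and>
        f \<in> Hom Comp (discrete_topology S) X \<and>
        a \<in> mmap F (discrete_topology S) X f ` topspace (omap F (discrete_topology S)))"

definition incl :: "'a set \<Rightarrow> 'a \<Rightarrow> 'a" where
  "incl A = (\<lambda>x\<in>A. x)"

text \<open>A family of closed sets enters only through the set of its members. The intersection
  of the empty family is the whole space.\<close>

definition preserves_intersections :: "('a, 'b) comp_func \<Rightarrow> bool" where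
  "preserves_intersections G \<longleftrightarrow>
     (\<forall>X\<in>Obj Comp. \<forall>\<K>. (\<forall>K\<in>\<K>. closedin X K) \<longrightarrow>
        (let im = (\<lambda>K. mmap G (subtopology X K) X (incl K) ` topspace (omap G (subtopology X K)))
         in im (topspace X \<inter> \<Inter>\<K>) = topspace (omap G X) \<inter> (\<Inter>K\<in>\<K>. im K)))"

section \<open>The maximal modification on the empty space\<close>

text \<open>The finite ordinals are placed in the universe by an injection \<open>e\<close>.\<close>

definition ord :: "(nat \<Rightarrow> 'a) \<Rightarrow> nat \<Rightarrow> 'a topology" where
  "ord e n = discrete_topology (e ` {..<n})"

definition const_map :: "(nat \<Rightarrow> 'a) \<Rightarrow> nat \<Rightarrow> 'a \<Rightarrow> 'a" where
  "const_map e i = (\<lambda>x\<in>topspace (ord e 1). e i)"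

definition empty_value :: "(nat \<Rightarrow> 'a) \<Rightarrow> ('a, 'b) comp_func \<Rightarrow> 'b topology" where
  "empty_value e F = subtopology (omap F (ord e 1))
     {a \<in> topspace (omap F (ord e 1)).
        mmap F (ord e 1) (ord e 2) (const_map e 0) a =
        mmap F (ord e 1) (ord e 2) (const_map e 1) a}"

text \<open>The choice of the map from the one-point space is irrelevant, see
  \<open>max_empty_mod_eq\<close> below.\<close>

definition max_empty_mod :: "(nat \<Rightarrow> 'a) \<Rightarrow> ('a, 'b) comp_func \<Rightarrow> ('a, 'b) comp_func" where
  "max_empty_mod e F = \<lparr>
     omap = (\<lambda>X. if topspace X = {} then empty_value e F else omap F X),
     mmap = (\<lambda>X Y f.
       if topspace X \<noteq> {} then mmap F X Y f
       else if topspace Y = {} then Ident TopSet (empty_value e F)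
       else restrict (mmap F (ord e 1) Y (SOME g. g \<in> Hom Comp (ord e 1) Y))
              (topspace (empty_value e F)))\<rparr>"

section \<open>Adequacy of the definitions\<close>

lemma Obj_Comp [simp]: "X \<in> Obj Comp \<longleftrightarrow> compact_space X \<and> Hausdorff_space X"
  by (simp add: Comp_def)

lemma Hom_Comp: "f \<in> Hom Comp X Y \<longleftrightarrow> continuous_map X Y f \<and> f \<in> extensional (topspace X)"
  by (simp add: Comp_def)

lemma Cmp_Comp [simp]: "Cmp Comp X = compose (topspace X)"
  by (simp add: Comp_def)

lemma Obj_TopSet [simp]: "X \<in> Obj TopSet"
  by (simp add: TopSet_def)

lemma Hom_TopSet [simp]: "Hom TopSet X Y = topspace X \<rightarrow>\<^sub>E topspace Y"
  by (simp add: TopSet_def)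

lemma Cmp_TopSet [simp]: "Cmp TopSet X = compose (topspace X)"
  by (simp add: TopSet_def)

lemma Ident_TopSet [simp]: "Ident TopSet X = (\<lambda>x\<in>topspace X. x)"
  by (simp add: TopSet_def)

lemma Ident_Comp [simp]: "Ident Comp X = (\<lambda>x\<in>topspace X. x)"
  by (simp add: Comp_def)

lemma Hom_Comp_PiE: "f \<in> Hom Comp X Y \<Longrightarrow> f \<in> topspace X \<rightarrow>\<^sub>E topspace Y"
  by (auto simp: Hom_Comp PiE_def continuous_map_def)

lemma discrete_Obj_Comp: "finite S \<Longrightarrow> discrete_topology S \<in> Obj Comp"
  by (simp add: compact_space_discrete_topology Hausdorff_space_discrete_topology)

lemma discrete_Hom_Comp: "f \<in> S \<rightarrow>\<^sub>E topspace X \<Longrightarrow> f \<in> Hom Comp (discrete_topology S) X"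
  by (auto simp: Hom_Comp PiE_def)

lemma compose_inj_cancel:
  assumes "inj_on f B" "g \<in> A \<rightarrow>\<^sub>E B" "h \<in> A \<rightarrow>\<^sub>E B" "compose A f g = compose A f h"
  shows "g = h"
proof (rule PiE_ext[OF assms(2,3)])
  fix x assume "x \<in> A"
  then have "f (g x) = f (h x)" "g x \<in> B" "h x \<in> B"
    using assms(2,3) fun_cong[OF assms(4), of x] by (auto simp: compose_eq)
  then show "g x = h x" using assms(1) by (auto dest: inj_onD)
qed

lemma compose_surj_cancel:
  assumes "f ` A = B" "g \<in> B \<rightarrow>\<^sub>E C" "h \<in> B \<rightarrow>\<^sub>E C" "compose A g f = compose A h f"
  shows "g = h"
proof (rule PiE_ext[OF assms(2,3)])
  fix y assume "y \<in> B"
  then obtain x where "x \<in> A" "y = f x" using assms(1) by auto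
  then show "g y = h y" using fun_cong[OF assms(4), of x] by (simp add: compose_eq)
qed

lemma is_mono_Comp_iff:
  "is_mono Comp X Y f \<longleftrightarrow> f \<in> Hom Comp X Y \<and> inj_on f (topspace X)"
proof (intro iffI conjI)
  assume m: "is_mono Comp X Y f"
  then show "f \<in> Hom Comp X Y" by (simp add: is_mono_def)
  show "inj_on f (topspace X)"
  proof (rule inj_onI)
    fix x y assume xy: "x \<in> topspace X" "y \<in> topspace X" "f x = f y"
    let ?Z = "discrete_topology {x}"
    have "(\<lambda>u\<in>{x}. x) \<in> Hom Comp ?Z X" "(\<lambda>u\<in>{x}. y) \<in> Hom Comp ?Z X"
      using xy by (auto intro!: discrete_Hom_Comp)
    moreover have "Cmp Comp ?Z f (\<lambda>u\<in>{x}. x) = Cmp Comp ?Z f (\<lambda>u\<in>{x}. y)"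
      using xy by (auto simp: compose_def)
    moreover have "?Z \<in> Obj Comp" by (rule discrete_Obj_Comp) simp
    ultimately have "(\<lambda>u\<in>{x}. x) = (\<lambda>u\<in>{x}. y)"
      using m unfolding is_mono_def by blast
    then show "x = y" by (metis restrict_apply' singletonI)
  qed
next
  assume "f \<in> Hom Comp X Y \<and> inj_on f (topspace X)"
  then have f: "f \<in> Hom Comp X Y" "inj_on f (topspace X)" by blast+
  have "g = h" if "g \<in> Hom Comp Z X" "h \<in> Hom Comp Z X" "Cmp Comp Z f g = Cmp Comp Z f h" for Z g h
    using compose_inj_cancel[OF f(2) that(1)[THEN Hom_Comp_PiE] that(2)[THEN Hom_Comp_PiE]] that(3)
    by simp
  then show "is_mono Comp X Y f"
    unfolding is_mono_def using f by blast
qed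

lemma is_mono_TopSet_iff:
  "is_mono TopSet X Y f \<longleftrightarrow> f \<in> Hom TopSet X Y \<and> inj_on f (topspace X)"
proof (intro iffI conjI)
  assume m: "is_mono TopSet X Y f"
  then show "f \<in> Hom TopSet X Y" by (simp add: is_mono_def)
  show "inj_on f (topspace X)"
  proof (rule inj_onI)
    fix x y assume xy: "x \<in> topspace X" "y \<in> topspace X" "f x = f y"
    let ?Z = "discrete_topology {x}"
    have "(\<lambda>u\<in>{x}. x) \<in> Hom TopSet ?Z X" "(\<lambda>u\<in>{x}. y) \<in> Hom TopSet ?Z X"
      using xy by auto
    moreover have "Cmp TopSet ?Z f (\<lambda>u\<in>{x}. x) = Cmp TopSet ?Z f (\<lambda>u\<in>{x}. y)"
      using xy by (auto simp: compose_def)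
    moreover have "?Z \<in> Obj TopSet" by simp
    ultimately have "(\<lambda>u\<in>{x}. x) = (\<lambda>u\<in>{x}. y)"
      using m unfolding is_mono_def by blast
    then show "x = y" by (metis restrict_apply' singletonI)
  qed
next
  assume "f \<in> Hom TopSet X Y \<and> inj_on f (topspace X)"
  then have f: "f \<in> Hom TopSet X Y" "inj_on f (topspace X)" by blast+
  have "g = h" if "g \<in> Hom TopSet Z X" "h \<in> Hom TopSet Z X" "Cmp TopSet Z f g = Cmp TopSet Z f h" for Z g h
    using compose_inj_cancel[OF f(2) that(1)[unfolded Hom_TopSet] that(2)[unfolded Hom_TopSet]] that(3)
    by simp
  then show "is_mono TopSet X Y f"
    unfolding is_mono_def using f by blast
qed

lemma is_epi_TopSet_iff:
  fixes f :: "'b \<Rightarrow> 'b"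
  assumes "\<exists>u v :: 'b. u \<noteq> v"
  shows "is_epi TopSet X Y f \<longleftrightarrow> f \<in> Hom TopSet X Y \<and> f ` topspace X = topspace Y"
proof (intro iffI conjI)
  assume m: "is_epi TopSet X Y f"
  then show f: "f \<in> Hom TopSet X Y" by (simp add: is_epi_def)
  obtain u v :: 'b where uv: "u \<noteq> v" using assms by blast
  show "f ` topspace X = topspace Y"
  proof (rule ccontr)
    assume "f ` topspace X \<noteq> topspace Y"
    then obtain y where y: "y \<in> topspace Y" "y \<notin> f ` topspace X" using f by auto
    let ?Z = "discrete_topology (UNIV :: 'b set)"
    let ?g = "\<lambda>w\<in>topspace Y. u" and ?h = "\<lambda>w\<in>topspace Y. if w = y then v else u"
    have "?g \<in> Hom TopSet Y ?Z" "?h \<in> Hom TopSet Y ?Z" by auto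
    moreover have "Cmp TopSet X ?g f = Cmp TopSet X ?h f"
      using y by (auto simp: compose_def fun_eq_iff restrict_def)
    ultimately have "?g = ?h" using m Obj_TopSet unfolding is_epi_def by blast
    then have "?g y = ?h y" by (rule fun_cong)
    then show False using y uv by simp
  qed
next
  assume "f \<in> Hom TopSet X Y \<and> f ` topspace X = topspace Y"
  then have f: "f \<in> Hom TopSet X Y" "f ` topspace X = topspace Y" by blast+
  have "g = h" if "g \<in> Hom TopSet Y Z" "h \<in> Hom TopSet Y Z" "Cmp TopSet X g f = Cmp TopSet X h f" for Z g h
    using compose_surj_cancel[OF f(2) that(1)[unfolded Hom_TopSet] that(2)[unfolded Hom_TopSet]] that(3)
    by simp
  then show "is_epi TopSet X Y f"
    unfolding is_epi_def using f by blast
qed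

lemma collapse_closed:
  assumes Y: "compact_space Y" "Hausdorff_space Y" and K: "closedin Y K" and p: "p \<in> K"
  defines "q \<equiv> \<lambda>y. if y \<in> K then p else y"
  obtains Z where "compact_space Z" "Hausdorff_space Z" "continuous_map Y Z q"
proof -
  define P where "P U \<longleftrightarrow> U \<subseteq> q ` topspace Y \<and> openin Y {y \<in> topspace Y. q y \<in> U}" for U
  have ist: "istopology P"
    unfolding istopology_def
  proof (intro conjI allI impI)
    fix S T assume "P S" "P T"
    moreover have "{y \<in> topspace Y. q y \<in> S \<inter> T} =
        {y \<in> topspace Y. q y \<in> S} \<inter> {y \<in> topspace Y. q y \<in> T}" by auto
    ultimately show "P (S \<inter> T)" unfolding P_def by auto
  next
    fix \<U> assume a: "\<forall>S\<in>\<U>. P S"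
    have "{y \<in> topspace Y. q y \<in> \<Union>\<U>} = (\<Union>S\<in>\<U>. {y \<in> topspace Y. q y \<in> S})" by auto
    then show "P (\<Union>\<U>)" using a unfolding P_def by auto
  qed
  define Z where "Z = topology P"
  have op: "openin Z U \<longleftrightarrow> P U" for U
    by (simp add: Z_def topology_inverse'[OF ist])
  have "{y \<in> topspace Y. q y \<in> q ` topspace Y} = topspace Y" by auto
  then have "P (q ` topspace Y)" by (simp add: P_def)
  then have ts: "topspace Z = q ` topspace Y"
    unfolding topspace_def[of Z] op unfolding P_def by blast
  have cont: "continuous_map Y Z q"
    unfolding continuous_map using op ts P_def by auto
  have "compact_space Z"
    using image_compactin[OF _ cont, of "topspace Y"] Y ts by (simp add: compact_space_def)
  moreover have "Hausdorff_space Z"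
    unfolding Hausdorff_space_def
  proof (intro allI impI)
    fix a b assume ab: "a \<in> topspace Z \<and> b \<in> topspace Z \<and> a \<noteq> b"
    let ?fib = "\<lambda>a. {y \<in> topspace Y. q y = a}"
    have KY: "K \<subseteq> topspace Y" using K closedin_subset by blast
    have fib: "?fib c = (if c = p then K else {c})" if "c \<in> topspace Z" for c
      using that KY p ts by (auto simp: q_def split: if_splits)
    have cl: "closedin Y (?fib c)" if "c \<in> topspace Z" for c
    proof (cases "c = p")
      case True then show ?thesis using fib[OF that] K by simp
    next
      case False
      moreover have "c \<in> topspace Y" using that ts KY p by (auto simp: q_def)
      ultimately show ?thesis
        using fib[OF that] Y closedin_Hausdorff_singleton by metis
    qed
    have "disjnt (?fib a) (?fib b)" using ab by (auto simp: disjnt_iff)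
    moreover have "normal_space Y"
      using Y by (simp add: compact_Hausdorff_or_regular_imp_normal_space)
    moreover have "closedin Y (?fib a)" "closedin Y (?fib b)" using cl ab by blast+
    ultimately have "\<exists>U V. openin Y U \<and> openin Y V \<and> ?fib a \<subseteq> U \<and> ?fib b \<subseteq> V \<and> disjnt U V"
      unfolding normal_space_def by simp
    then obtain U V where UV: "openin Y U" "openin Y V" "?fib a \<subseteq> U" "?fib b \<subseteq> V"
        "disjnt U V"
      by blast
    define s where "s W = (if K \<subseteq> W then W else W - K)" for W
    have "x = y \<or> x \<in> K \<and> y \<in> K" if "q x = q y" for x y
      using that p by (auto simp: q_def split: if_splits)
    moreover have "y \<in> s W" if "x \<in> s W" "x \<in> K" "y \<in> K" for x y W
      using that unfolding s_def by (cases "K \<subseteq> W") auto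
    ultimately have "y \<in> s W" if "x \<in> s W" "q y = q x" for x y W
      using that by metis
    then have sat: "q y \<in> q ` s W \<longleftrightarrow> y \<in> s W" for W y
      by blast
    have os: "openin Z (q ` s W)" if "openin Y W" for W
    proof -
      have W: "W \<subseteq> topspace Y" using that openin_subset by blast
      have "{y \<in> topspace Y. q y \<in> q ` s W} = s W"
        using sat W by (auto simp: s_def split: if_splits)
      moreover have "openin Y (s W)" using that K by (auto simp: s_def)
      ultimately show ?thesis
        using W unfolding op P_def by (auto simp: s_def split: if_splits)
    qed
    have mem: "c \<in> q ` s W" if "c \<in> topspace Z" "?fib c \<subseteq> W" for c W
    proof (cases "c = p")
      case True
      then have "K \<subseteq> W" using fib that by auto
      then show ?thesis using True p by (auto simp: s_def q_def intro!: image_eqI[of _ _ p])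
    next
      case False
      then have "c \<in> W" using fib[OF that(1)] that by auto
      moreover have "c \<notin> K" using False that ts p by (auto simp: q_def split: if_splits)
      ultimately show ?thesis by (auto simp: s_def q_def intro!: image_eqI[of _ _ c])
    qed
    have "disjnt (q ` s U) (q ` s V)"
    proof -
      have "False" if "x \<in> s U" "y \<in> s V" "q x = q y" for x y
      proof -
        have "q x \<in> q ` s V" using that by auto
        then have "x \<in> s V" using sat by simp
        then show False using that UV by (auto simp: s_def disjnt_iff split: if_splits)
      qed
      then show ?thesis by (auto simp: disjnt_iff)
    qed
    then show "\<exists>U V. openin Z U \<and> openin Z V \<and> a \<in> U \<and> b \<in> V \<and> disjnt U V"
      using os UV mem ab by metis
  qed
  ultimately show thesis using that cont by blast
qed

lemma is_epi_Comp_iff: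
  fixes f :: "'a \<Rightarrow> 'a"
  assumes "\<exists>u v :: 'a. u \<noteq> v" and X: "X \<in> Obj Comp" and Y: "Y \<in> Obj Comp"
  shows "is_epi Comp X Y f \<longleftrightarrow> f \<in> Hom Comp X Y \<and> f ` topspace X = topspace Y"
proof (intro iffI conjI)
  assume m: "is_epi Comp X Y f"
  then show f: "f \<in> Hom Comp X Y" by (simp add: is_epi_def)
  show "f ` topspace X = topspace Y"
  proof (rule ccontr)
    assume "f ` topspace X \<noteq> topspace Y"
    then obtain y where y: "y \<in> topspace Y" "y \<notin> f ` topspace X"
      using Hom_Comp_PiE[OF f] by auto
    obtain Z :: "'a topology" and g h where Z: "Z \<in> Obj Comp"
      and gh: "continuous_map Y Z g" "continuous_map Y Z h"
        "\<And>x. x \<in> topspace X \<Longrightarrow> g (f x) = h (f x)" "g y \<noteq> h y"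
    proof (cases "topspace X = {}")
      case True
      obtain u v :: 'a where uv: "u \<noteq> v" using assms by blast
      have "discrete_topology {u, v} \<in> Obj Comp" by (rule discrete_Obj_Comp) simp
      moreover have "continuous_map Y (discrete_topology {u, v}) (\<lambda>_. u)"
        "continuous_map Y (discrete_topology {u, v}) (\<lambda>_. v)" by auto
      ultimately show ?thesis
        using that[of "discrete_topology {u, v}" "\<lambda>_. u" "\<lambda>_. v"] uv True by simp
    next
      case False
      then obtain x0 where x0: "x0 \<in> topspace X" by blast
      let ?K = "f ` topspace X"
      have "compactin Y ?K"
        using X f by (auto simp: Hom_Comp compact_space_def intro: image_compactin)
      then have K: "closedin Y ?K" using Y by (simp add: compactin_imp_closedin)
      have p: "f x0 \<in> ?K" using x0 by simp
      from Y have Y': "compact_space Y" "Hausdorff_space Y" by simp_all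
      obtain Z where Z: "compact_space Z" "Hausdorff_space Z"
        "continuous_map Y Z (\<lambda>y. if y \<in> ?K then f x0 else y)"
        by (rule collapse_closed[OF Y' K p])
      have "f x0 \<in> topspace Y" using Hom_Comp_PiE[OF f] x0 by auto
      then have "f x0 \<in> topspace Z"
        using continuous_map_image_subset_topspace[OF Z(3)] p by force
      then have "continuous_map Y Z (\<lambda>_. f x0)" by simp
      moreover have "y \<noteq> f x0" using y p by metis
      ultimately show ?thesis
        using that[of Z "\<lambda>_. f x0" "\<lambda>y. if y \<in> ?K then f x0 else y"] Z y by simp
    qed
    let ?g = "restrict g (topspace Y)" and ?h = "restrict h (topspace Y)"
    have "?g \<in> Hom Comp Y Z" "?h \<in> Hom Comp Y Z"
      using continuous_map_eq[OF gh(1), of ?g] continuous_map_eq[OF gh(2), of ?h]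
      by (simp_all add: Hom_Comp)
    moreover have "Cmp Comp X ?g f = Cmp Comp X ?h f"
      using gh Hom_Comp_PiE[OF f] by (auto simp: compose_def fun_eq_iff restrict_def)
    ultimately have "?g = ?h" using m Z unfolding is_epi_def by blast
    then have "?g y = ?h y" by (rule fun_cong)
    then show False using y gh by simp
  qed
next
  assume "f \<in> Hom Comp X Y \<and> f ` topspace X = topspace Y"
  then have f: "f \<in> Hom Comp X Y" "f ` topspace X = topspace Y" by blast+
  have "g = h" if "g \<in> Hom Comp Y Z" "h \<in> Hom Comp Y Z" "Cmp Comp X g f = Cmp Comp X h f" for Z g h
    using compose_surj_cancel[OF f(2) that(1)[THEN Hom_Comp_PiE] that(2)[THEN Hom_Comp_PiE]] that(3)
    by simp
  then show "is_epi Comp X Y f"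
    unfolding is_epi_def using f by blast
qed

lemma topspace_ord [simp]: "topspace (ord e n) = e ` {..<n}"
  by (simp add: ord_def)

lemma ord_Obj_Comp: "ord e n \<in> Obj Comp"
  unfolding ord_def by (rule discrete_Obj_Comp) simp

lemma ord_Hom_Comp: "f \<in> e ` {..<n} \<rightarrow>\<^sub>E topspace X \<Longrightarrow> f \<in> Hom Comp (ord e n) X"
  unfolding ord_def by (rule discrete_Hom_Comp)

lemma topspace_empty_value:
  "topspace (empty_value e F) = {a \<in> topspace (omap F (ord e 1)).
        mmap F (ord e 1) (ord e 2) (const_map e 0) a =
        mmap F (ord e 1) (ord e 2) (const_map e 1) a}"
  by (auto simp: empty_value_def)

lemma functor_Hom:
  "is_functor Comp TopSet F \<Longrightarrow> X \<in> Obj Comp \<Longrightarrow> Y \<in> Obj Comp \<Longrightarrow> f \<in> Hom Comp X Y \<Longrightarrow>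
   mmap F X Y f \<in> topspace (omap F X) \<rightarrow>\<^sub>E topspace (omap F Y)"
  by (simp add: is_functor_def)

lemma functor_Cmp:
  "is_functor Comp TopSet F \<Longrightarrow> X \<in> Obj Comp \<Longrightarrow> Y \<in> Obj Comp \<Longrightarrow> Z \<in> Obj Comp \<Longrightarrow>
   f \<in> Hom Comp X Y \<Longrightarrow> g \<in> Hom Comp Y Z \<Longrightarrow> a \<in> topspace (omap F X) \<Longrightarrow>
   mmap F X Z (compose (topspace X) g f) a = mmap F Y Z g (mmap F X Y f a)"
  by (simp add: is_functor_def compose_eq)

lemma empty_value_indep:
  assumes e: "inj e" and F: "is_functor Comp TopSet F" and Y: "Y \<in> Obj Comp"
    and g: "g \<in> Hom Comp (ord e 1) Y" and h: "h \<in> Hom Comp (ord e 1) Y"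
    and a: "a \<in> topspace (empty_value e F)"
  shows "mmap F (ord e 1) Y g a = mmap F (ord e 1) Y h a"
proof -
  define k where "k = (\<lambda>x\<in>e ` {..<2}. if x = e 0 then g (e 0) else h (e 0))"
  have gh: "g \<in> {e 0} \<rightarrow>\<^sub>E topspace Y" "h \<in> {e 0} \<rightarrow>\<^sub>E topspace Y"
    using Hom_Comp_PiE[OF g] Hom_Comp_PiE[OF h] by (simp_all add: lessThan_Suc)
  have e01: "e 1 \<noteq> e 0" using e by (auto dest: injD)
  have k: "k \<in> Hom Comp (ord e 2) Y"
    using gh by (intro ord_Hom_Comp) (auto simp: k_def)
  have c: "const_map e i \<in> Hom Comp (ord e 1) (ord e 2)" if "i < 2" for i
    using that by (intro ord_Hom_Comp) (auto simp: const_map_def)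
  have one: "topspace (ord e 1) = {e 0}" by (simp add: lessThan_Suc)
  have und: "g x = undefined" "h x = undefined" if "x \<noteq> e 0" for x
    using gh[THEN PiE_arb, of x] that by simp_all
  have "e 0 \<in> e ` {..<2}" "e 1 \<in> e ` {..<2}" by auto
  then have "k (e 0) = g (e 0)" "k (e 1) = h (e 0)" using e01 unfolding k_def by simp_all
  then have "compose (topspace (ord e 1)) k (const_map e 0) = g"
    "compose (topspace (ord e 1)) k (const_map e 1) = h"
    unfolding one compose_def const_map_def fun_eq_iff by (simp_all add: und restrict_def)
  moreover have "a \<in> topspace (omap F (ord e 1))"
    "mmap F (ord e 1) (ord e 2) (const_map e 0) a = mmap F (ord e 1) (ord e 2) (const_map e 1) a"
    using a by (auto simp: topspace_empty_value)
  ultimately show ?thesis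
    using functor_Cmp[OF F ord_Obj_Comp ord_Obj_Comp Y c k, of 0 a]
      functor_Cmp[OF F ord_Obj_Comp ord_Obj_Comp Y c k, of 1 a] by simp
qed

lemma point_Hom_Comp: "y \<in> topspace Y \<Longrightarrow> (\<lambda>x\<in>e ` {..<1}. y) \<in> Hom Comp (ord e 1) Y"
  by (intro ord_Hom_Comp) auto

lemma max_empty_mod_eq:
  assumes e: "inj e" and F: "is_functor Comp TopSet F" and Y: "Y \<in> Obj Comp"
    and X: "topspace X = {}" and g: "g \<in> Hom Comp (ord e 1) Y"
  shows "mmap (max_empty_mod e F) X Y f = (if topspace Y = {} then Ident TopSet (empty_value e F)
    else restrict (mmap F (ord e 1) Y g) (topspace (empty_value e F)))"
proof -
  have "(SOME g. g \<in> Hom Comp (ord e 1) Y) \<in> Hom Comp (ord e 1) Y"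
    using someI[of "\<lambda>g. g \<in> Hom Comp (ord e 1) Y", OF g] .
  then show ?thesis
    using X empty_value_indep[OF e F Y _ g]
    by (simp add: max_empty_mod_def restrict_def fun_eq_iff)
qed

lemma max_empty_mod_nonempty:
  "topspace X \<noteq> {} \<Longrightarrow> omap (max_empty_mod e F) X = omap F X"
  "topspace X \<noteq> {} \<Longrightarrow> mmap (max_empty_mod e F) X Y f = mmap F X Y f"
  by (simp_all add: max_empty_mod_def)

lemma max_empty_mod_empty:
  "topspace X = {} \<Longrightarrow> omap (max_empty_mod e F) X = empty_value e F"
  "topspace X = {} \<Longrightarrow> topspace Y = {} \<Longrightarrow>
     mmap (max_empty_mod e F) X Y f = Ident TopSet (empty_value e F)"
  by (simp_all add: max_empty_mod_def)

theorem is_functor_max_empty_mod: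
  fixes e :: "nat \<Rightarrow> 'a" and F :: "('a, 'b) comp_func"
  assumes e: "inj e" and F: "is_functor Comp TopSet F"
  shows "is_functor Comp TopSet (max_empty_mod e F)"
proof -
  let ?G = "max_empty_mod e F" and ?E = "empty_value e F"
  have E_sub: "a \<in> topspace (omap F (ord e 1))" if "a \<in> topspace ?E" for a
    using that by (simp add: topspace_empty_value)
  have hom: "mmap ?G X Y f \<in> topspace (omap ?G X) \<rightarrow>\<^sub>E topspace (omap ?G Y)"
    if X: "X \<in> Obj Comp" and Y: "Y \<in> Obj Comp" and f: "f \<in> Hom Comp X Y" for X Y f
  proof (cases "topspace X = {}")
    case False
    then have "topspace Y \<noteq> {}" using Hom_Comp_PiE[OF f] by fastforce
    then show ?thesis
      using False functor_Hom[OF F X Y f] by (simp add: max_empty_mod_def)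
  next
    case True
    show ?thesis
    proof (cases "topspace Y = {}")
      case ye: True
      show ?thesis
        by (simp only: max_empty_mod_empty[OF True] max_empty_mod_empty[OF ye]
            max_empty_mod_empty(2)[OF True ye]) auto
    next
      case False
      then obtain y where "y \<in> topspace Y" by blast
      note g = point_Hom_Comp[OF this, of e]
      have "restrict (mmap F (ord e 1) Y (\<lambda>x\<in>e ` {..<1}. y)) (topspace ?E)
          \<in> topspace ?E \<rightarrow>\<^sub>E topspace (omap F Y)"
        using functor_Hom[OF F ord_Obj_Comp Y g] E_sub by auto
      then show ?thesis
        by (simp only: max_empty_mod_empty(1)[OF True] max_empty_mod_nonempty(1)[OF False]
            max_empty_mod_eq[OF e F Y True g] False if_False)
    qed
  qed
  have idn: "mmap ?G X X (Ident Comp X) = Ident TopSet (omap ?G X)" if X: "X \<in> Obj Comp" for X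
  proof (cases "topspace X = {}")
    case True
    then show ?thesis by (simp add: max_empty_mod_def)
  next
    case False
    then show ?thesis using F X by (simp add: max_empty_mod_def is_functor_def)
  qed
  have cmp: "mmap ?G X Z (compose (topspace X) g f) =
      compose (topspace (omap ?G X)) (mmap ?G Y Z g) (mmap ?G X Y f)"
    if X: "X \<in> Obj Comp" and Y: "Y \<in> Obj Comp" and Z: "Z \<in> Obj Comp"
      and f: "f \<in> Hom Comp X Y" and g: "g \<in> Hom Comp Y Z" for X Y Z f g
  proof (cases "topspace X = {}")
    case False
    then have "topspace Y \<noteq> {}" using Hom_Comp_PiE[OF f] by fastforce
    moreover have "mmap F X Z (compose (topspace X) g f) =
        compose (topspace (omap F X)) (mmap F Y Z g) (mmap F X Y f)"
      using F X Y Z f g unfolding is_functor_def Cmp_Comp Cmp_TopSet by blast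
    ultimately show ?thesis using False by (simp add: max_empty_mod_def)
  next
    case X0: True
    show ?thesis
    proof (cases "topspace Y = {}")
      case Y0: True
      have "topspace ?E = topspace (omap ?G Y)"
        by (simp only: max_empty_mod_empty(1)[OF Y0])
      moreover have "X = Y" using X0 Y0 by simp
      ultimately have "mmap ?G Y Z g \<in> extensional (topspace ?E)"
        using hom[OF Y Z g] by (simp add: PiE_def)
      moreover have "mmap ?G X Z (compose (topspace X) g f) = mmap ?G Y Z g"
        using X0 \<open>X = Y\<close> by (simp add: max_empty_mod_def)
      ultimately show ?thesis
        by (simp only: max_empty_mod_empty(1)[OF X0] max_empty_mod_empty(2)[OF X0 Y0]
            Ident_TopSet)
           (auto simp: compose_def fun_eq_iff restrict_def extensional_def)
    next
      case Y1: False
      then obtain y where y: "y \<in> topspace Y" by blast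
      note k = point_Hom_Comp[OF y, of e]
      have gy: "g y \<in> topspace Z" using Hom_Comp_PiE[OF g] y by auto
      then have Z1: "topspace Z \<noteq> {}" by auto
      note l = point_Hom_Comp[OF gy, of e]
      have kl: "compose (topspace (ord e 1)) g (\<lambda>x\<in>e ` {..<1}. y) = (\<lambda>x\<in>e ` {..<1}. g y)"
        by (auto simp: compose_def fun_eq_iff restrict_def)
      have "mmap F (ord e 1) Z (\<lambda>x\<in>e ` {..<1}. g y) a =
          mmap F Y Z g (mmap F (ord e 1) Y (\<lambda>x\<in>e ` {..<1}. y) a)" if "a \<in> topspace ?E" for a
        using functor_Cmp[OF F ord_Obj_Comp Y Z k g E_sub[OF that]] unfolding kl .
      then show ?thesis
        by (simp only: max_empty_mod_empty(1)[OF X0] max_empty_mod_nonempty(2)[OF Y1]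
            max_empty_mod_eq[OF e F Y X0 k] max_empty_mod_eq[OF e F Z X0 l] Y1 Z1 if_False)
           (auto simp: compose_def fun_eq_iff restrict_def)
    qed
  qed
  show ?thesis
    unfolding is_functor_def using hom idn cmp by simp
qed

theorem monomorphic_max_empty_mod:
  fixes e :: "nat \<Rightarrow> 'a" and F :: "('a, 'b) comp_func"
  assumes e: "inj e" and F: "is_functor Comp TopSet F" and m: "monomorphic Comp TopSet F"
  shows "monomorphic Comp TopSet (max_empty_mod e F)"
  unfolding monomorphic_def
proof (intro ballI allI impI)
  fix X Y :: "'a topology" and f
  assume X: "X \<in> Obj Comp" and Y: "Y \<in> Obj Comp" and mf: "is_mono Comp X Y f"
  let ?G = "max_empty_mod e F" and ?E = "empty_value e F"
  have f: "f \<in> Hom Comp X Y" using mf by (simp add: is_mono_def)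
  have hom: "mmap ?G X Y f \<in> Hom TopSet (omap ?G X) (omap ?G Y)"
    using is_functor_max_empty_mod[OF e F] X Y f unfolding is_functor_def by blast
  have inj: "inj_on (mmap F V Y h) (topspace (omap F V))"
    if "V \<in> Obj Comp" "is_mono Comp V Y h" for V h
    using m that Y unfolding monomorphic_def is_mono_TopSet_iff by blast
  have "inj_on (mmap ?G X Y f) (topspace (omap ?G X))"
  proof (cases "topspace X = {}")
    case False
    then show ?thesis using inj[OF X mf] by (simp add: max_empty_mod_def)
  next
    case X0: True
    show ?thesis
    proof (cases "topspace Y = {}")
      case True
      then show ?thesis
        by (simp only: max_empty_mod_empty(1)[OF X0] max_empty_mod_empty(2)[OF X0 True]
            Ident_TopSet) (auto intro!: inj_onI)
    next
      case Y1: False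
      then obtain y where y: "y \<in> topspace Y" by blast
      note k = point_Hom_Comp[OF y, of e]
      then have "is_mono Comp (ord e 1) Y (\<lambda>x\<in>e ` {..<1}. y)"
        by (auto simp: is_mono_Comp_iff intro!: inj_onI)
      from inj[OF ord_Obj_Comp this]
      have "inj_on (mmap F (ord e 1) Y (\<lambda>x\<in>e ` {..<1}. y)) (topspace ?E)"
        by (rule inj_on_subset) (auto simp: topspace_empty_value)
      then show ?thesis
        by (simp only: max_empty_mod_empty(1)[OF X0] max_empty_mod_eq[OF e F Y X0 k] Y1 if_False
            inj_on_restrict_eq)
    qed
  qed
  then show "is_mono TopSet (omap ?G X) (omap ?G Y) (mmap ?G X Y f)"
    using hom by (simp only: is_mono_TopSet_iff)
qed

end

theory Submission
  imports Defs
begin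

text \<open>
  For a functor \<open>G\<close> and a closed subset \<open>K\<close> of \<open>X\<close>, say that \<open>K\<close> carries \<open>a \<in> G X\<close> if \<open>a\<close> comes
  from \<open>G K\<close> along the inclusion. Finite supports say that every element is carried by a finite set.

  A surjection has a section over any finite set, in general discontinuous, but a finite discrete
  space does not notice this. So a finite support of an element of \<open>F Y\<close> can be lifted through
  a surjection \<open>X \<rightarrow> Y\<close>, and \<open>F\<close> is epimorphic.

  For intersections, the same freedom gives many maps out of a finite set. Let finite
  sets \<open>A\<close> and \<open>C\<close> both carry \<open>a\<close>. As \<open>F\<close> preserves the injectivity of \<open>A \<union> C \<rightarrow> X\<close>, the element
  \<open>a\<close> already lives on \<open>A \<union> C\<close> and is carried there by both sets. The map \<open>A \<union> C \<rightarrow> X\<close> that is the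
  identity on \<open>C\<close> and sends \<open>A - C\<close> to a point \<open>p\<close> fixes \<open>a\<close> because \<open>C\<close> carries \<open>a\<close>, and
  it sends \<open>a\<close> to something carried by \<open>(A \<inter> C) \<union> {p}\<close> because \<open>A\<close> carries \<open>a\<close>
  (\<open>carried_collapse\<close>). If \<open>A\<close> and \<open>C\<close> meet, take \<open>p\<close> in \<open>A \<inter> C\<close>. If they are disjoint and
  non-empty, then \<open>a\<close> is carried by each point of \<open>X\<close>, in particular by two different ones; this
  is exactly what the set \<open>F\<^sup>\<circ> \<emptyset>\<close> was made for, and \<open>a\<close> comes from it (\<open>carried_empty\<close>).
  So for \<open>F\<^sup>\<circ>\<close> the intersection of two finite carriers of \<open>a\<close> is again a carrier, and one of the two
  may as well be closed and infinite (\<open>carried_Int_closed\<close>). A finite carrier of least size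
  therefore lies in every closed carrier, hence in the intersection of any family of them.
\<close>

section \<open>Elements carried by a closed subset\<close>

definition carried :: "('a, 'b) comp_func \<Rightarrow> 'a topology \<Rightarrow> 'a set \<Rightarrow> 'b set" where
  "carried G X K = mmap G (subtopology X K) X (incl K) ` topspace (omap G (subtopology X K))"

lemma closedin_subtopology_Obj:
  "X \<in> Obj Comp \<Longrightarrow> closedin X K \<Longrightarrow> subtopology X K \<in> Obj Comp"
  by (simp add: Hausdorff_space_subtopology closedin_compact_space compact_space_subtopology)

lemma finite_closedin:
  "X \<in> Obj Comp \<Longrightarrow> A \<subseteq> topspace X \<Longrightarrow> finite A \<Longrightarrow> closedin X A"
  by (simp add: closedin_Hausdorff_finite)

lemma topspace_subtopology_closedin:
  "closedin X K \<Longrightarrow> topspace (subtopology X K) = K"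
  by (simp add: closedin_subset inf.absorb2)

lemma restrict_Hom_Comp:
  assumes "f \<in> Hom Comp X Y" "closedin X K" "closedin Y L" "f ` K \<subseteq> L"
  shows "restrict f K \<in> Hom Comp (subtopology X K) (subtopology Y L)"
proof -
  have "continuous_map (subtopology X K) Y f"
    using assms(1) by (simp add: Hom_Comp continuous_map_from_subtopology)
  then have "continuous_map (subtopology X K) (subtopology Y L) f"
    using assms(4) by (auto simp: continuous_map_in_subtopology)
  then have "continuous_map (subtopology X K) (subtopology Y L) (restrict f K)"
    by (rule continuous_map_eq) (simp add: topspace_subtopology_closedin[OF assms(2)])
  then show ?thesis
    by (simp only: Hom_Comp topspace_subtopology_closedin[OF assms(2)] restrict_extensional simp_thms)
qed

lemma Ident_Hom_Comp: "Ident Comp X \<in> Hom Comp X X"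
  using continuous_map_eq[OF continuous_map_id, of X "\<lambda>x\<in>topspace X. x"] by (simp add: Hom_Comp)

lemma incl_Hom_Comp:
  assumes "closedin X K" "closedin X L" "K \<subseteq> L"
  shows "incl K \<in> Hom Comp (subtopology X K) (subtopology X L)"
proof -
  have "restrict (Ident Comp X) K = incl K"
    using closedin_subset[OF assms(1)] by (auto simp: incl_def restrict_def fun_eq_iff)
  then show ?thesis
    using restrict_Hom_Comp[OF Ident_Hom_Comp assms(1,2)] assms(3) closedin_subset[OF assms(1)]
    by auto
qed

lemma incl_Hom_Comp_space:
  "closedin X K \<Longrightarrow> incl K \<in> Hom Comp (subtopology X K) X"
  using incl_Hom_Comp[of X K "topspace X"] by (simp add: closedin_subset)

lemma carried_subset:
  assumes "is_functor Comp TopSet G" "X \<in> Obj Comp" "closedin X K"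
  shows "carried G X K \<subseteq> topspace (omap G X)"
  using functor_Hom[OF assms(1) closedin_subtopology_Obj[OF assms(2,3)] assms(2)
      incl_Hom_Comp_space[OF assms(3)]]
  by (auto simp: carried_def)

lemma carried_topspace:
  assumes "is_functor Comp TopSet G" "X \<in> Obj Comp"
  shows "carried G X (topspace X) = topspace (omap G X)"
proof -
  have "incl (topspace X) = Ident Comp X" by (simp add: incl_def)
  then have "mmap G X X (incl (topspace X)) = (\<lambda>a\<in>topspace (omap G X). a)"
    using assms by (simp add: is_functor_def)
  then show ?thesis by (simp add: carried_def)
qed

lemma carried_image:
  assumes G: "is_functor Comp TopSet G" and X: "X \<in> Obj Comp" and Y: "Y \<in> Obj Comp"
    and f: "f \<in> Hom Comp X Y" and K: "closedin X K" and L: "closedin Y L" and fK: "f ` K \<subseteq> L"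
    and a: "a \<in> carried G X K"
  shows "mmap G X Y f a \<in> carried G Y L"
proof -
  let ?K = "subtopology X K" and ?L = "subtopology Y L"
  obtain b where b: "b \<in> topspace (omap G ?K)" "a = mmap G ?K X (incl K) b"
    using a by (auto simp: carried_def)
  note K' = closedin_subtopology_Obj[OF X K] and L' = closedin_subtopology_Obj[OF Y L]
  note h = restrict_Hom_Comp[OF f K L fK]
  have "compose (topspace ?K) f (incl K) = compose (topspace ?K) (incl L) (restrict f K)"
    using fK topspace_subtopology_closedin[OF K] by (auto simp: compose_def incl_def restrict_def fun_eq_iff)
  then have "mmap G X Y f a = mmap G ?L Y (incl L) (mmap G ?K ?L (restrict f K) b)"
    using functor_Cmp[OF G K' X Y incl_Hom_Comp_space[OF K] f b(1)]
      functor_Cmp[OF G K' L' Y h incl_Hom_Comp_space[OF L] b(1)] b(2) by simp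
  moreover have "mmap G ?K ?L (restrict f K) b \<in> topspace (omap G ?L)"
    using functor_Hom[OF G K' L' h] b(1) by auto
  ultimately show ?thesis by (simp add: carried_def)
qed

lemma carried_mono:
  assumes "is_functor Comp TopSet G" "X \<in> Obj Comp" "closedin X K" "closedin X L" "K \<subseteq> L"
  shows "carried G X K \<subseteq> carried G X L"
proof
  fix a assume a: "a \<in> carried G X K"
  have "Ident Comp X ` K \<subseteq> L" using assms(5) closedin_subset[OF assms(3)] by auto
  then have "mmap G X X (Ident Comp X) a \<in> carried G X L"
    using carried_image[OF assms(1,2,2) Ident_Hom_Comp assms(3,4) _ a] by blast
  moreover have "mmap G X X (Ident Comp X) a = a"
    using assms(1,2) carried_subset[OF assms(1-3)] a by (auto simp: is_functor_def)
  ultimately show "a \<in> carried G X L" by simp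
qed

lemma mmap_eq_on_carrier:
  assumes G: "is_functor Comp TopSet G" and X: "X \<in> Obj Comp" and Y: "Y \<in> Obj Comp"
    and f: "f \<in> Hom Comp X Y" and g: "g \<in> Hom Comp X Y" and K: "closedin X K"
    and fg: "\<And>x. x \<in> K \<Longrightarrow> f x = g x" and a: "a \<in> carried G X K"
  shows "mmap G X Y f a = mmap G X Y g a"
proof -
  let ?K = "subtopology X K"
  obtain b where b: "b \<in> topspace (omap G ?K)" "a = mmap G ?K X (incl K) b"
    using a by (auto simp: carried_def)
  have "compose (topspace ?K) f (incl K) = compose (topspace ?K) g (incl K)"
    using fg topspace_subtopology_closedin[OF K] by (auto simp: compose_def incl_def restrict_def fun_eq_iff)
  then show ?thesis
    using functor_Cmp[OF G closedin_subtopology_Obj[OF X K] X Y incl_Hom_Comp_space[OF K] f b(1)]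
      functor_Cmp[OF G closedin_subtopology_Obj[OF X K] X Y incl_Hom_Comp_space[OF K] g b(1)] b(2)
    by simp
qed

lemma carried_lift:
  assumes G: "is_functor Comp TopSet G" and X: "X \<in> Obj Comp"
    and K: "closedin X K" and D: "closedin X D" and KD: "K \<subseteq> D" and a: "a \<in> carried G X K"
  obtains d where "d \<in> carried G (subtopology X D) K" "mmap G (subtopology X D) X (incl D) d = a"
proof -
  let ?K = "subtopology X K" and ?D = "subtopology X D"
  obtain b where b: "b \<in> topspace (omap G ?K)" "a = mmap G ?K X (incl K) b"
    using a by (auto simp: carried_def)
  have KK: "subtopology ?D K = ?K"
    using KD by (simp add: subtopology_subtopology inf.absorb2)
  have "compose (topspace ?K) (incl D) (incl K) = incl K"
    using KD topspace_subtopology_closedin[OF K] by (auto simp: compose_def incl_def restrict_def fun_eq_iff)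
  then have "mmap G ?D X (incl D) (mmap G ?K ?D (incl K) b) = a"
    using functor_Cmp[OF G closedin_subtopology_Obj[OF X K] closedin_subtopology_Obj[OF X D] X
        incl_Hom_Comp[OF K D KD] incl_Hom_Comp_space[OF D] b(1)] b(2) by simp
  moreover have "mmap G ?K ?D (incl K) b \<in> carried G ?D K"
    using b(1) by (simp add: carried_def KK)
  ultimately show ?thesis using that by blast
qed

lemma monomorphic_inj_on:
  assumes "monomorphic Comp TopSet G" "X \<in> Obj Comp" "Y \<in> Obj Comp" "f \<in> Hom Comp X Y"
    "inj_on f (topspace X)"
  shows "inj_on (mmap G X Y f) (topspace (omap G X))"
  using assms unfolding monomorphic_def is_mono_Comp_iff is_mono_TopSet_iff by blast

section \<open>Two finite carriers\<close>

text \<open>The inclusion of \<open>A \<union> C\<close> into \<open>X\<close> and its modification that sends \<open>A - C\<close> to \<open>p\<close> agree on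
  the carrier \<open>C\<close>, so they have the same value at the element of \<open>G (A \<union> C)\<close> over \<open>a\<close>.
  Monomorphy is what makes the elements over \<open>a\<close> that come from \<open>A\<close> and from \<open>C\<close> equal.\<close>

lemma carried_collapse:
  assumes G: "is_functor Comp TopSet G" and mono: "monomorphic Comp TopSet G" and X: "X \<in> Obj Comp"
    and A: "finite A" "A \<subseteq> topspace X" and C: "finite C" "C \<subseteq> topspace X" and p: "p \<in> topspace X"
    and aA: "a \<in> carried G X A" and aC: "a \<in> carried G X C"
  shows "a \<in> carried G X (insert p (A \<inter> C))"
proof -
  let ?D = "subtopology X (A \<union> C)"
  define r where "r = (\<lambda>x\<in>A \<union> C. if x \<in> C then x else p)"
  have Ac: "closedin X A" and Cc: "closedin X C" and Dc: "closedin X (A \<union> C)"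
    and Lc: "closedin X (insert p (A \<inter> C))"
    using A C p by (auto intro!: finite_closedin[OF X])
  note D = closedin_subtopology_Obj[OF X Dc] and i = incl_Hom_Comp_space[OF Dc]
  have tD: "topspace ?D = A \<union> C" by (rule topspace_subtopology_closedin[OF Dc])
  have "?D = discrete_topology (A \<union> C)"
    using finite_t1_space_imp_discrete_topology[OF tD] A C D by (simp add: Hausdorff_imp_t1_space)
  moreover have "r \<in> A \<union> C \<rightarrow>\<^sub>E topspace X"
    using A C p by (auto simp: r_def)
  ultimately have r: "r \<in> Hom Comp ?D X" by (simp add: discrete_Hom_Comp)
  have AcD: "closedin ?D A" and CcD: "closedin ?D C"
    using A C by (auto intro!: finite_closedin[OF D] simp: tD)
  obtain d where d: "d \<in> carried G ?D A" "mmap G ?D X (incl (A \<union> C)) d = a"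
    using carried_lift[OF G X Ac Dc _ aA] by auto
  obtain d' where d': "d' \<in> carried G ?D C" "mmap G ?D X (incl (A \<union> C)) d' = a"
    using carried_lift[OF G X Cc Dc _ aC] by auto
  have "inj_on (mmap G ?D X (incl (A \<union> C))) (topspace (omap G ?D))"
    by (rule monomorphic_inj_on[OF mono D X i]) (unfold tD, simp add: incl_def inj_on_def)
  then have "d = d'"
    using d d' carried_subset[OF G D AcD] carried_subset[OF G D CcD] by (auto dest!: inj_onD)
  have "a = mmap G ?D X r d'"
    using mmap_eq_on_carrier[OF G D X i r CcD _ d'(1)] d'(2) by (simp add: r_def incl_def)
  moreover have "mmap G ?D X r d \<in> carried G X (insert p (A \<inter> C))"
    by (rule carried_image[OF G D X r AcD Lc _ d(1)]) (auto simp: r_def)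
  ultimately show ?thesis using \<open>d = d'\<close> by simp
qed

section \<open>The modified functor\<close>

lemma carried_max_empty_mod:
  "closedin X K \<Longrightarrow> K \<noteq> {} \<Longrightarrow> carried (max_empty_mod e F) X K = carried F X K"
  using topspace_subtopology_closedin[of X K]
  by (simp add: carried_def max_empty_mod_nonempty del: topspace_subtopology)

text \<open>The candidate in \<open>F 1\<close> is the image \<open>u\<close> of \<open>a\<close> under the map \<open>X \<rightarrow> 1\<close>. If a point \<open>x\<close> carries
  \<open>a\<close>, the constant self-map of \<open>X\<close> with value \<open>x\<close> fixes \<open>a\<close>, and as it factors through \<open>1\<close>, the
  map \<open>1 \<rightarrow> X\<close> to \<open>x\<close> sends \<open>u\<close> to \<open>a\<close>. The two points \<open>p \<noteq> q\<close> embed \<open>2\<close> in \<open>X\<close>, and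
  monomorphy pulls the equality of the two images of \<open>u\<close> back from \<open>F X\<close> to \<open>F 2\<close>.\<close>

lemma carried_empty:
  fixes e :: "nat \<Rightarrow> 'a" and F :: "('a, 'b) comp_func"
  assumes e: "inj e" and F: "is_functor Comp TopSet F" and mono: "monomorphic Comp TopSet F"
    and X: "X \<in> Obj Comp" and p: "p \<in> topspace X" and q: "q \<in> topspace X" and pq: "p \<noteq> q"
    and ap: "a \<in> carried F X {p}" and aq: "a \<in> carried F X {q}"
  shows "a \<in> carried (max_empty_mod e F) X {}"
proof -
  define t where "t = (\<lambda>x\<in>topspace X. e 0)"
  define k where "k x = (\<lambda>y\<in>e ` {..<1}. x)" for x :: 'a
  define u where "u = mmap F X (ord e 1) t a"
  have one: "e ` {..<1} = {e 0}" by (simp add: lessThan_Suc)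
  have t: "t \<in> Hom Comp X (ord e 1)"
    using continuous_map_eq[of X "ord e 1" "\<lambda>_. e 0" t] by (auto simp: t_def Hom_Comp)
  have k: "k x \<in> Hom Comp (ord e 1) X" if "x \<in> topspace X" for x
    unfolding k_def using that by (rule point_Hom_Comp)
  have pc: "closedin X {x}" if "x \<in> topspace X" for x
    using that by (auto intro: finite_closedin[OF X])
  have aX: "a \<in> topspace (omap F X)" using carried_subset[OF F X pc[OF p]] ap by blast
  have u: "u \<in> topspace (omap F (ord e 1))"
    unfolding u_def using functor_Hom[OF F X ord_Obj_Comp t] aX by auto
  have ku: "mmap F (ord e 1) X (k x) u = a" if x: "x \<in> topspace X" and ax: "a \<in> carried F X {x}" for x
  proof -
    let ?c = "compose (topspace X) (k x) t"
    have c: "?c = (\<lambda>y\<in>topspace X. x)"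
      by (auto simp: compose_def k_def t_def fun_eq_iff)
    have ch: "?c \<in> Hom Comp X X"
      using continuous_map_eq[of X X "\<lambda>_. x" ?c] x by (simp add: c Hom_Comp)
    have "mmap F X X ?c a = mmap F X X (Ident Comp X) a"
      by (rule mmap_eq_on_carrier[OF F X X ch Ident_Hom_Comp pc[OF x] _ ax]) (simp add: c)
    also have "\<dots> = a" using F X aX by (simp add: is_functor_def)
    finally show ?thesis
      using functor_Cmp[OF F X ord_Obj_Comp X t k[OF x] aX] by (simp add: u_def)
  qed
  define j where "j = (\<lambda>x\<in>e ` {..<2}. if x = e 0 then p else q)"
  have e01: "e 1 \<noteq> e 0" using e by (auto dest: injD)
  have two: "e ` {..<2} = {e 0, e 1}" by (auto simp: numeral_2_eq_2 lessThan_Suc)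
  have j: "j \<in> Hom Comp (ord e 2) X"
    using p q by (intro ord_Hom_Comp) (auto simp: j_def)
  have "inj_on j (topspace (ord e 2))"
    using pq e01 by (auto simp: two j_def inj_on_def)
  then have ij: "inj_on (mmap F (ord e 2) X j) (topspace (omap F (ord e 2)))"
    by (rule monomorphic_inj_on[OF mono ord_Obj_Comp X j])
  have c: "const_map e i \<in> Hom Comp (ord e 1) (ord e 2)" if "i < 2" for i
    using that by (intro ord_Hom_Comp) (auto simp: const_map_def)
  have jc: "compose (topspace (ord e 1)) j (const_map e 0) = k p"
    "compose (topspace (ord e 1)) j (const_map e 1) = k q"
    using e01 by (auto simp: compose_def const_map_def k_def j_def two one fun_eq_iff restrict_def)
  have jcu: "mmap F (ord e 2) X j (mmap F (ord e 1) (ord e 2) (const_map e i) u) = a"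
    if "i = 0 \<or> i = 1" for i
    using that functor_Cmp[OF F ord_Obj_Comp ord_Obj_Comp X c j u, of i] jc ku[OF p ap] ku[OF q aq]
    by auto
  have cu: "mmap F (ord e 1) (ord e 2) (const_map e i) u \<in> topspace (omap F (ord e 2))" if "i < 2" for i
    using functor_Hom[OF F ord_Obj_Comp ord_Obj_Comp c[OF that]] u by auto
  have "mmap F (ord e 1) (ord e 2) (const_map e 0) u = mmap F (ord e 1) (ord e 2) (const_map e 1) u"
    by (rule inj_onD[OF ij]) (simp_all add: jcu cu del: One_nat_def)
  then have uE: "u \<in> topspace (empty_value e F)"
    using u by (simp add: topspace_empty_value)
  have nX: "topspace X \<noteq> {}" using p by blast
  have e0: "topspace (subtopology X {}) = {}" by simp
  have "mmap (max_empty_mod e F) (subtopology X {}) X (incl {}) u = a"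
    unfolding max_empty_mod_eq[OF e F X e0 k[OF p]] using nX uE ku[OF p ap] by simp
  then show ?thesis
    unfolding carried_def max_empty_mod_empty(1)[OF e0] using uE by blast
qed

lemma finite_carrier:
  fixes e :: "nat \<Rightarrow> 'a" and F :: "('a, 'b) comp_func"
  assumes e: "inj e" and F: "is_functor Comp TopSet F" and fin: "finite_supports F"
    and X: "X \<in> Obj Comp" and a: "a \<in> topspace (omap (max_empty_mod e F) X)"
  obtains A where "finite A" "A \<subseteq> topspace X" "a \<in> carried (max_empty_mod e F) X A"
proof (cases "topspace X = {}")
  case True
  then show ?thesis
    using that[of "topspace X"] a carried_topspace[OF is_functor_max_empty_mod[OF e F] X] by simp
next
  case False
  then obtain x where x: "x \<in> topspace X" by blast
  have "a \<in> topspace (omap F X)" using a False by (simp add: max_empty_mod_nonempty)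
  then obtain S f where S: "finite S" and f: "f \<in> Hom Comp (discrete_topology S) X"
    and af: "a \<in> mmap F (discrete_topology S) X f ` topspace (omap F (discrete_topology S))"
    using fin X unfolding finite_supports_def by blast
  let ?S = "discrete_topology S" and ?A = "insert x (f ` S)"
  \<comment> \<open>The point \<open>x\<close> is added because \<open>S\<close> may be empty, and on the empty space \<open>F\<close> and its
    modification may differ.\<close>
  note S' = discrete_Obj_Comp[OF S]
  have A: "finite ?A" "?A \<subseteq> topspace X"
    using S x Hom_Comp_PiE[OF f] by auto
  have Ac: "closedin X ?A" by (rule finite_closedin[OF X A(2,1)])
  obtain b where b: "b \<in> topspace (omap F ?S)" "a = mmap F ?S X f b" using af by blast
  have "b \<in> carried F ?S S" using carried_topspace[OF F S'] b(1) by simp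
  then have "mmap F ?S X f b \<in> carried F X ?A"
    using carried_image[OF F S' X f _ Ac, of S b] by auto
  then show ?thesis
    using that[OF A] carried_max_empty_mod[OF Ac, of e F] b(2) by simp
qed

lemma carried_Int_finite:
  fixes e :: "nat \<Rightarrow> 'a" and F :: "('a, 'b) comp_func"
  assumes e: "inj e" and F: "is_functor Comp TopSet F" and mono: "monomorphic Comp TopSet F"
    and X: "X \<in> Obj Comp"
    and A: "finite A" "A \<subseteq> topspace X" and C: "finite C" "C \<subseteq> topspace X"
    and aA: "a \<in> carried (max_empty_mod e F) X A" and aC: "a \<in> carried (max_empty_mod e F) X C"
  shows "a \<in> carried (max_empty_mod e F) X (A \<inter> C)"
proof -
  let ?G = "max_empty_mod e F"
  note collapse = carried_collapse[OF is_functor_max_empty_mod[OF e F]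
      monomorphic_max_empty_mod[OF e F mono] X A C _ aA aC]
  show ?thesis
  proof (cases "A \<inter> C = {}")
    case False
    then obtain p where p: "p \<in> A" "p \<in> C" by blast
    then show ?thesis using collapse[of p] A by (auto simp: insert_absorb)
  next
    case True
    show ?thesis
    proof (cases "A = {} \<or> C = {}")
      case True
      then show ?thesis using aA aC by auto
    next
      case False
      then obtain p q where pq: "p \<in> A" "q \<in> C" by blast
      then have "p \<noteq> q" using True by blast
      have pX: "p \<in> topspace X" and qX: "q \<in> topspace X" using pq A C by auto
      have "a \<in> carried F X {x}" if "x \<in> topspace X" for x
        using collapse[OF that] True carried_max_empty_mod[of X "{x}" e F]
          finite_closedin[OF X, of "{x}"] that
        by simp
      then show ?thesis
        using carried_empty[OF e F mono X pX qX \<open>p \<noteq> q\<close>] pX qX True by simp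
    qed
  qed
qed

text \<open>The element of \<open>F\<^sup>\<circ> B\<close> over \<open>a\<close> has a finite carrier of its own, so \<open>B\<close> can be replaced by
  a finite subset.\<close>

lemma carried_Int_closed:
  fixes e :: "nat \<Rightarrow> 'a" and F :: "('a, 'b) comp_func"
  assumes e: "inj e" and F: "is_functor Comp TopSet F" and mono: "monomorphic Comp TopSet F"
    and fin: "finite_supports F" and X: "X \<in> Obj Comp"
    and A: "finite A" "A \<subseteq> topspace X" and B: "closedin X B"
    and aA: "a \<in> carried (max_empty_mod e F) X A" and aB: "a \<in> carried (max_empty_mod e F) X B"
  shows "a \<in> carried (max_empty_mod e F) X (A \<inter> B)"
proof -
  let ?G = "max_empty_mod e F" and ?B = "subtopology X B"
  note G = is_functor_max_empty_mod[OF e F] and B' = closedin_subtopology_Obj[OF X B]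
  note tB = topspace_subtopology_closedin[OF B]
  obtain b where b: "b \<in> topspace (omap ?G ?B)" "a = mmap ?G ?B X (incl B) b"
    using aB unfolding carried_def by blast
  obtain C where C: "finite C" "C \<subseteq> B" "b \<in> carried ?G ?B C"
    using finite_carrier[OF e F fin B' b(1)] unfolding tB by blast
  have CX: "C \<subseteq> topspace X" using C(2) closedin_subset[OF B] by blast
  have Cc: "closedin ?B C" by (rule finite_closedin[OF B' _ C(1)]) (simp only: tB C(2))
  have "a \<in> carried ?G X C"
    unfolding b(2)
    by (rule carried_image[OF G B' X incl_Hom_Comp_space[OF B] Cc finite_closedin[OF X CX C(1)] _ C(3)])
      (use C(2) in \<open>auto simp: incl_def\<close>)
  then have "a \<in> carried ?G X (A \<inter> C)"
    by (rule carried_Int_finite[OF e F mono X A C(1) CX aA])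
  moreover have "carried ?G X (A \<inter> C) \<subseteq> carried ?G X (A \<inter> B)"
    by (rule carried_mono[OF G X]) (use A C(2) CX in \<open>auto intro!: finite_closedin[OF X]\<close>)
  ultimately show ?thesis by blast
qed

theorem preserves_intersections_max_empty_mod:
  fixes e :: "nat \<Rightarrow> 'a" and F :: "('a, 'b) comp_func"
  assumes e: "inj e" and F: "is_functor Comp TopSet F" and mono: "monomorphic Comp TopSet F"
    and fin: "finite_supports F"
  shows "preserves_intersections (max_empty_mod e F)"
proof -
  let ?G = "max_empty_mod e F"
  note G = is_functor_max_empty_mod[OF e F]
  have "carried ?G X (topspace X \<inter> \<Inter>\<K>) = topspace (omap ?G X) \<inter> (\<Inter>K\<in>\<K>. carried ?G X K)"
    if X: "X \<in> Obj Comp" and \<K>: "\<forall>K\<in>\<K>. closedin X K" for X \<K>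
  proof
    let ?Z = "topspace X \<inter> \<Inter>\<K>"
    have Z: "closedin X ?Z"
      using closedin_Inter[of "insert (topspace X) \<K>" X] \<K> by auto
    show "carried ?G X ?Z \<subseteq> topspace (omap ?G X) \<inter> (\<Inter>K\<in>\<K>. carried ?G X K)"
    proof (intro Int_greatest INT_greatest)
      show "carried ?G X ?Z \<subseteq> topspace (omap ?G X)" by (rule carried_subset[OF G X Z])
      show "carried ?G X ?Z \<subseteq> carried ?G X K" if "K \<in> \<K>" for K
        using carried_mono[OF G X Z, of K] \<K> that by auto
    qed
    show "topspace (omap ?G X) \<inter> (\<Inter>K\<in>\<K>. carried ?G X K) \<subseteq> carried ?G X ?Z"
    proof
      fix a assume a: "a \<in> topspace (omap ?G X) \<inter> (\<Inter>K\<in>\<K>. carried ?G X K)"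
      define P where "P A \<longleftrightarrow> finite A \<and> A \<subseteq> topspace X \<and> a \<in> carried ?G X A" for A
      have aX: "a \<in> topspace (omap ?G X)" using a by (rule IntD1)
      have aK: "a \<in> carried ?G X K" if "K \<in> \<K>" for K using a that by simp
      have "\<exists>A. P A" unfolding P_def by (rule finite_carrier[OF e F fin X aX]) blast
      then obtain A where A: "P A" and least: "\<And>B. P B \<Longrightarrow> card A \<le> card B"
        using ex_has_least_nat[of P _ card] by blast
      have fA: "finite A" "A \<subseteq> topspace X" "a \<in> carried ?G X A" using A by (auto simp: P_def)
      have "A \<subseteq> K" if "K \<in> \<K>" for K
      proof -
        have "a \<in> carried ?G X (A \<inter> K)"
          by (rule carried_Int_closed[OF e F mono fin X fA(1,2) _ fA(3) aK[OF that]])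
            (use \<K> that in blast)
        then have "card A \<le> card (A \<inter> K)" by (intro least) (use fA in \<open>auto simp: P_def\<close>)
        then have "A \<inter> K = A" by (rule card_seteq[OF fA(1) Int_lower1])
        then show ?thesis by blast
      qed
      then have "A \<subseteq> ?Z" using fA(2) by blast
      then show "a \<in> carried ?G X ?Z"
        by (rule subsetD[OF carried_mono[OF G X finite_closedin[OF X fA(2,1)] Z] fA(3)])
    qed
  qed
  then show ?thesis
    unfolding preserves_intersections_def Let_def carried_def[symmetric] by simp
qed

section \<open>Surjections\<close>

text \<open>The section of \<open>h\<close> over the finite support is an arbitrary function, continuous because its
  domain is discrete.\<close>

theorem epimorphic_finite_supports:
  fixes F :: "('a, 'b) comp_func"
  assumes uv: "\<exists>u v :: 'a. u \<noteq> v"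
    and F: "is_functor Comp TopSet F" and fin: "finite_supports F"
  shows "epimorphic Comp TopSet F"
  unfolding epimorphic_def
proof (intro ballI allI impI)
  fix X Y :: "'a topology" and h
  assume X: "X \<in> Obj Comp" and Y: "Y \<in> Obj Comp" and "is_epi Comp X Y h"
  then have h: "h \<in> Hom Comp X Y" "h ` topspace X = topspace Y"
    using is_epi_Comp_iff[OF uv X Y] by blast+
  note Fh = functor_Hom[OF F X Y h(1)]
  have "b \<in> mmap F X Y h ` topspace (omap F X)" if b: "b \<in> topspace (omap F Y)" for b
  proof -
    obtain S f c where S: "finite S" and f: "f \<in> Hom Comp (discrete_topology S) Y"
      and c: "c \<in> topspace (omap F (discrete_topology S))" "b = mmap F (discrete_topology S) Y f c"
      using fin Y b unfolding finite_supports_def by blast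
    let ?S = "discrete_topology S"
    note S' = discrete_Obj_Comp[OF S]
    have fS: "f \<in> S \<rightarrow>\<^sub>E topspace Y" using Hom_Comp_PiE[OF f] by simp
    define g where "g = (\<lambda>s\<in>S. inv_into (topspace X) h (f s))"
    have "g \<in> S \<rightarrow>\<^sub>E topspace X"
      unfolding g_def using fS h(2) by (auto intro!: inv_into_into)
    then have g: "g \<in> Hom Comp ?S X" by (rule discrete_Hom_Comp)
    have "compose (topspace ?S) h g = f"
    proof (rule PiE_ext)
      show "compose (topspace ?S) h g \<in> S \<rightarrow>\<^sub>E topspace Y"
        using Hom_Comp_PiE[OF g] Hom_Comp_PiE[OF h(1)] by (auto simp: compose_def)
      show "compose (topspace ?S) h g s = f s" if "s \<in> S" for s
        using that fS h(2) by (auto simp: compose_def g_def intro!: f_inv_into_f)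
    qed (rule fS)
    then have "b = mmap F X Y h (mmap F ?S X g c)"
      using functor_Cmp[OF F S' X Y g h(1) c(1)] c(2) by simp
    moreover have "mmap F ?S X g c \<in> topspace (omap F X)"
      using functor_Hom[OF F S' X g] c(1) by auto
    ultimately show ?thesis by blast
  qed
  then have surj: "mmap F X Y h ` topspace (omap F X) = topspace (omap F Y)"
    using Fh by auto
  show "is_epi TopSet (omap F X) (omap F Y) (mmap F X Y h)"
    unfolding is_epi_def Hom_TopSet Cmp_TopSet using Fh by (blast intro: compose_surj_cancel[OF surj])
qed

theorem theorem3:
  fixes e :: "nat \<Rightarrow> 'a" and F :: "('a, 'b) comp_func"
  assumes "inj e"
    and "is_functor Comp TopSet F"
    and "monomorphic Comp TopSet F"
    and "finite_supports F"
  shows "epimorphic Comp TopSet F \<and> preserves_intersections (max_empty_mod e F)"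
proof
  have "e 0 \<noteq> e 1" using assms(1) by (auto dest: injD)
  then show "epimorphic Comp TopSet F"
    using epimorphic_finite_supports[OF _ assms(2,4)] by blast
  show "preserves_intersections (max_empty_mod e F)"
    by (rule preserves_intersections_max_empty_mod[OF assms])
qed

end
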